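(* Let $\mathbb K$ be a subfield of $\mathbb R$ that is a finite algebraic extension of $\mathbb Q$. Then there exists a sign pattern matrix $A$ such that for every subfield $\mathbb K_1\subset\mathbb R$ with $\mathbb K\not\subseteq\mathbb K_1$, one has $\mathrm{mr}_{\mathbb K}(A)<\mathrm{mr}_{\mathbb K_1}(A)$.
   Context: A sign pattern matrix is a matrix with entries in $\{+,-,0\}$. For a real matrix $B$, $\mathrm{sgn}(B)$ is the sign pattern matrix obtained by replacing each positive (resp. negative, zero) entry of $B$ by $+$ (resp. $-$, $0$). For a sign pattern matrix $A$ and a subfield $\mathbb F$ of $\mathbb R$, $Q_{\mathbb F}(A)=\{B : B \text{ has entries in } \mathbb F,\ \mathrm{sgn}(B)=A\}$ and $\mathrm{mr}_{\mathbb F}(A)=\min_{B\in Q_{\mathbb F}(A)}\mathrm{rank}(B)$ (the minimum rank of $A$ over $\mathbb F$). *)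

theory Defs
  imports
    Complex_Main
    "HOL-Algebra.Embedded_Algebras"
    "Jordan_Normal_Form.DL_Rank"
begin

datatype sign_entry = Plus | Minus | Zero

type_synonym sign_pattern = "sign_entry mat"

definition sign_of :: "real \<Rightarrow> sign_entry" where
  "sign_of x = (if x > 0 then Plus else if x < 0 then Minus else Zero)"

definition sgn_mat :: "real mat \<Rightarrow> sign_pattern" where
  "sgn_mat B = map_mat sign_of B"

definition qual_class :: "real set \<Rightarrow> sign_pattern \<Rightarrow> real mat set" where
  "qual_class F A = {B. elements_mat B \<subseteq> F \<and> sgn_mat B = A}"

text \<open>The rank is taken over the reals. For a matrix with entries in a subfield it agrees with
  the rank over that subfield.\<close>

definition real_rank :: "real mat \<Rightarrow> nat" where
  "real_rank B = vec_space.rank (dim_row B) B"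

definition min_rank :: "real set \<Rightarrow> sign_pattern \<Rightarrow> nat" where
  "min_rank F A = (LEAST r. \<exists>B \<in> qual_class F A. real_rank B = r)"

definition real_subfield :: "real set \<Rightarrow> bool" where
  "real_subfield K \<longleftrightarrow> subfield K (class_ring :: real ring)"

definition finite_ext_of_rat :: "real set \<Rightarrow> bool" where
  "finite_ext_of_rat K \<longleftrightarrow> ring.finite_dimension (class_ring :: real ring) \<rat> K"

lemma real_subfield_iff:
  "real_subfield K \<longleftrightarrow>
     0 \<in> K \<and> 1 \<in> K \<and> (\<forall>x\<in>K. \<forall>y\<in>K. x - y \<in> K \<and> x * y \<in> K) \<and> (\<forall>x\<in>K. inverse x \<in> K)"
  (is "?L \<longleftrightarrow> ?R")
proof
  have fld: "field (class_ring :: real ring)" by (rule class_field)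
  then have rg: "ring (class_ring :: real ring)" by (simp add: field_def domain_def cring_def)
  have um: "\<ominus>\<^bsub>class_ring\<^esub> x = - x" for x :: real
    using abelian_group.minus_equality[OF ring.is_abelian_group[OF rg], of "-x" x] by simp
  assume ?L
  then interpret subfield K "class_ring :: real ring" by (simp add: real_subfield_def)
  have sub: "subring K (class_ring :: real ring)" by (rule subring_axioms)
  have diff: "x - y \<in> K" if "x \<in> K" "y \<in> K" for x y
    using subringE(5)[OF sub that(2)] subringE(7)[OF sub that(1)] um by fastforce
  have inv: "inverse x \<in> K" if "x \<in> K" for x
  proof (cases "x = 0")
    case True then show ?thesis using that by simp
  next
    case False
    then have "x \<in> Units (class_ring \<lparr>carrier := K\<rparr>)" using that subfield_Units by simp
    then obtain y where "y \<in> K" "x * y = 1" by (auto simp: Units_def)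
    then show ?thesis by (metis inverse_unique)
  qed
  show ?R using diff inv subringE(2,3,6)[OF sub] by auto
next
  have fld: "field (class_ring :: real ring)" by (rule class_field)
  then have rg: "ring (class_ring :: real ring)" by (simp add: field_def domain_def cring_def)
  have um: "\<ominus>\<^bsub>class_ring\<^esub> x = - x" for x :: real
    using abelian_group.minus_equality[OF ring.is_abelian_group[OF rg], of "-x" x] by simp
  assume r: ?R
  have neg: "- x \<in> K" if "x \<in> K" for x using r that by (metis diff_0)
  have add: "x + y \<in> K" if "x \<in> K" "y \<in> K" for x y
    using r that neg by (metis diff_minus_eq_add)
  have "subring K (class_ring :: real ring)"
    by (rule ring.subringI[OF rg]) (use r add neg um in auto)
  then have "subcring K (class_ring :: real ring)"
    by (rule cring.subcringI'[OF fld[THEN field.axioms(1), THEN domain.axioms(1)]])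
  then show ?L
    unfolding real_subfield_def
    by (rule ring.subfieldI[OF rg]) (use r in \<open>auto simp: Units_def; metis right_inverse left_inverse\<close>)
qed

lemma real_subfield_Rats: "real_subfield \<rat>"
  by (auto simp: real_subfield_iff)

lemma finite_ext_of_rat_iff:
  "finite_ext_of_rat K \<longleftrightarrow>
     (\<exists>us. K = {sum_list (map2 (*) qs us) | qs. length qs = length us \<and> set qs \<subseteq> \<rat>})"
proof -
  have fld: "field (class_ring :: real ring)" by (rule class_field)
  then have rg: "ring (class_ring :: real ring)" by (simp add: field_def domain_def cring_def)
  have sf: "subfield \<rat> (class_ring :: real ring)"
    using real_subfield_Rats by (simp add: real_subfield_def)
  have comb: "ring.combine (class_ring :: real ring) qs us = sum_list (map2 (*) qs us)" for qs us
    by (induction qs us rule: ring.combine.induct[OF rg]) (auto simp: ring.combine.simps[OF rg])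
  have span: "ring.Span (class_ring :: real ring) \<rat> us =
      {sum_list (map2 (*) qs us) | qs. length qs = length us \<and> set qs \<subseteq> \<rat>}" for us
    using ring.Span_eq_combine_set_length_version[OF rg sf, of us] by (simp add: comb)
  have "ring.finite_dimension (class_ring :: real ring) \<rat> K \<longleftrightarrow> (\<exists>us. K = ring.Span (class_ring :: real ring) \<rat> us)"
  proof
    assume "ring.finite_dimension (class_ring :: real ring) \<rat> K"
    then obtain n where "ring.dimension (class_ring :: real ring) n \<rat> K" by (auto simp: ring.finite_dimension_def[OF rg])
    from ring.exists_base[OF rg sf this] show "\<exists>us. K = ring.Span (class_ring :: real ring) \<rat> us" by metis
  next
    assume "\<exists>us. K = ring.Span (class_ring :: real ring) \<rat> us"
    then show "ring.finite_dimension (class_ring :: real ring) \<rat> K" using ring.Span_finite_dimension[OF rg sf] by auto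
  qed
  then show ?thesis by (simp only: finite_ext_of_rat_def span)
qed

lemma min_rank_attained:
  assumes "real_subfield F"
  obtains B where "B \<in> qual_class F A" "real_rank B = min_rank F A"
    "\<And>C. C \<in> qual_class F A \<Longrightarrow> min_rank F A \<le> real_rank C"
proof -
  define v :: "sign_entry \<Rightarrow> real" where
    "v s = (case s of Plus \<Rightarrow> 1 | Minus \<Rightarrow> -1 | Zero \<Rightarrow> 0)" for s
  have sv: "sign_of (v s) = s" for s by (cases s) (auto simp: v_def sign_of_def)
  have mone: "-1 \<in> F"
    using assms unfolding real_subfield_iff by (metis diff_0)
  have "v s \<in> F" for s
    using assms by (cases s) (auto simp: v_def real_subfield_iff mone)
  then have "map_mat v A \<in> qual_class F A"
    by (auto simp: qual_class_def sgn_mat_def sv elements_mat_def intro!: eq_matI)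
  then have "\<exists>r. \<exists>B \<in> qual_class F A. real_rank B = r" by blast
  then have "\<exists>B \<in> qual_class F A. real_rank B = min_rank F A"
    unfolding min_rank_def by (rule LeastI_ex)
  then show thesis
    using that by (metis (mono_tags, lifting) Least_le min_rank_def)
qed

end

theory Submission
  imports Defs
begin

text \<open>For a finite set \<open>S\<close> of numbers containing 0 and 1, take the lines \<open>y = m x + c\<close>,
  \<open>x = c\<close> and the points \<open>(x, y)\<close> with parameters in \<open>S\<close>, together with the elements at infinity.
  The signs of the pairings of lines with points form a pattern of minimum rank at most 3 over any
  field containing \<open>S\<close>. As in von Staudt's construction, a realization of rank at most 3 over a
  field \<open>F\<close> has coordinates that give a strictly monotone \<open>f : S \<rightarrow> F\<close> with \<open>f 0 = 0\<close>, \<open>f 1 = 1\<close> and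
  \<open>f (m x + c) = f m f x + f c\<close> whenever all arguments lie in \<open>S\<close>. If \<open>S\<close> is large enough, such an \<open>f\<close>
  fixes any given algebraic number \<open>u\<close>: it fixes rationals, so by Horner's scheme it preserves a
  polynomial equation of \<open>u\<close> and by monotonicity it preserves an interval isolating \<open>u\<close> among the
  roots. Applied to generators of \<open>K\<close>, this gives \<open>K \<subseteq> F\<close>.\<close>

subsection \<open>Real subfields\<close>

lemma real_subfield_add:
  assumes "real_subfield F" "x \<in> F" "y \<in> F"
  shows "x + y \<in> F"
  using assms unfolding real_subfield_iff by (metis diff_0 diff_minus_eq_add)

lemma real_subfield_mult:
  assumes "real_subfield F" "x \<in> F" "y \<in> F"
  shows "x * y \<in> F"
  using assms unfolding real_subfield_iff by blast

lemma real_subfield_uminus: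
  assumes "real_subfield F" "x \<in> F"
  shows "- x \<in> F"
  using assms unfolding real_subfield_iff by (metis diff_0)

lemma real_subfield_divide:
  assumes "real_subfield F" "x \<in> F" "y \<in> F"
  shows "x / y \<in> F"
  using assms unfolding real_subfield_iff by (metis divide_inverse)

lemma Rats_subset_real_subfield:
  assumes "real_subfield F"
  shows "\<rat> \<subseteq> F"
proof
  have nat: "real n \<in> F" for n
    by (induction n) (use assms real_subfield_add[OF assms] in \<open>auto simp: real_subfield_iff\<close>)
  have int: "real_of_int z \<in> F" for z
    by (cases z) (use nat real_subfield_uminus[OF assms nat] in \<open>auto simp del: of_nat_Suc\<close>)
  fix x :: real
  assume "x \<in> \<rat>"
  then obtain a b where "x = real_of_int a / real_of_int b" by (auto elim: Rats_cases')
  then show "x \<in> F" by (simp add: real_subfield_divide[OF assms] int)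
qed

section \<open>Finite extensions of the rationals: generators and algebraicity\<close>

lemma sum_list_map2_replicate_zero:
  "sum_list (map2 (*) (replicate (length us) (0::real)) us) = 0"
  by (induction us) auto

lemma mem_rational_span:
  fixes us :: "real list"
  assumes "x \<in> set us"
  shows "\<exists>qs. x = sum_list (map2 (*) qs us) \<and> length qs = length us \<and> set qs \<subseteq> \<rat>"
  using assms
proof (induction us)
  case (Cons u us)
  show ?case
  proof (cases "x = u")
    case True
    then show ?thesis
      by (intro exI[of _ "1 # replicate (length us) 0"])
        (auto simp: sum_list_map2_replicate_zero)
  next
    case False
    then obtain qs where "x = sum_list (map2 (*) qs us)" "length qs = length us" "set qs \<subseteq> \<rat>"
      using Cons by auto
    then show ?thesis by (intro exI[of _ "0 # qs"]) auto
  qed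
qed simp

lemma rational_span_subset:
  assumes "real_subfield F" "set us \<subseteq> F" "length qs = length us" "set qs \<subseteq> \<rat>"
  shows "sum_list (map2 (*) qs us) \<in> F"
  using assms(3,2,4)
proof (induction qs us rule: list_induct2)
  case Nil
  then show ?case using assms(1) by (simp add: real_subfield_iff)
next
  case (Cons q qs u us)
  then show ?case
    using Rats_subset_real_subfield[OF assms(1)]
    by (auto intro!: real_subfield_add[OF assms(1)] real_subfield_mult[OF assms(1)])
qed

text \<open>A rational spanning list serves: every real subfield contains the rationals, hence all
  rational combinations of its elements.\<close>

lemma finite_ext_of_rat_generators:
  assumes "finite_ext_of_rat K"
  obtains G where "finite G" "G \<subseteq> K" "\<And>F. real_subfield F \<Longrightarrow> G \<subseteq> F \<Longrightarrow> K \<subseteq> F"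
proof -
  obtain us where us: "K = {sum_list (map2 (*) qs us) | qs. length qs = length us \<and> set qs \<subseteq> \<rat>}"
    using assms finite_ext_of_rat_iff by auto
  show thesis
  proof
    show "set us \<subseteq> K"
      unfolding us using mem_rational_span by blast
    show "K \<subseteq> F" if "real_subfield F" "set us \<subseteq> F" for F
      unfolding us using rational_span_subset[OF that] by blast
  qed simp
qed

text \<open>The powers of \<open>u\<close> lie in a finite-dimensional rational space, so they
  repeat or are linearly dependent; both give a polynomial equation.\<close>

lemma finite_ext_of_rat_algebraic:
  assumes "real_subfield K" "finite_ext_of_rat K" "u \<in> K"
  obtains p :: "real poly" where "p \<noteq> 0" "\<And>i. coeff p i \<in> \<rat>" "poly p u = 0"
proof -
  interpret rat: vector_space "\<lambda>(q::rat) (x::real). of_rat q * x"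
    by unfold_locales (auto simp: algebra_simps of_rat_add of_rat_mult)
  obtain us where us: "K = {sum_list (map2 (*) qs us) | qs. length qs = length us \<and> set qs \<subseteq> \<rat>}"
    using assms(2) finite_ext_of_rat_iff by auto
  have span: "sum_list (map2 (*) qs vs) \<in> rat.span (set us)"
    if "length qs = length vs" "set qs \<subseteq> \<rat>" "set vs \<subseteq> set us" for qs vs
    using that
  proof (induction qs vs rule: list_induct2)
    case Nil
    then show ?case using rat.span_zero by simp
  next
    case (Cons q qs v vs)
    then have "v \<in> rat.span (set us)" by (simp add: rat.span_base)
    moreover obtain r where "q = of_rat r" using Cons.prems by (auto elim: Rats_cases)
    ultimately have "q * v \<in> rat.span (set us)" using rat.span_scale by simp
    then show ?case using Cons by (auto intro: rat.span_add)
  qed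
  have pow: "u ^ k \<in> K" for k
    by (induction k) (use assms(1,3) in \<open>auto simp: real_subfield_iff\<close>)
  \<comment> \<open>Dependence concerns the set of powers. Injectivity lets each power determine its
    exponent, so that a relation becomes a polynomial.\<close>
  show thesis
  proof (cases "inj (\<lambda>k. u ^ k)")
    case False
    then obtain i j where ij: "i \<noteq> j" "u ^ i = u ^ j" by (auto simp: inj_def)
    have "coeff (monom (1::real) i - monom 1 j) i \<noteq> 0" using ij by simp
    then have "monom (1::real) i - monom 1 j \<noteq> 0" by (metis coeff_0)
    with ij show thesis
      by (intro that[of "monom 1 i - monom 1 j"]) (auto simp: poly_monom)
  next
    case True
    then have "infinite (range (\<lambda>k. u ^ k))" by (rule range_inj_infinite)
    moreover have "range (\<lambda>k. u ^ k) \<subseteq> rat.span (set us)"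
    proof (rule image_subsetI)
      fix k
      obtain qs where "u ^ k = sum_list (map2 (*) qs us)" "length qs = length us" "set qs \<subseteq> \<rat>"
        using pow[of k] us by blast
      then show "u ^ k \<in> rat.span (set us)" using span[of qs us] by simp
    qed
    ultimately have "rat.dependent (range (\<lambda>k. u ^ k))"
      using rat.independent_span_bound[of "set us"] by blast
    then obtain t c where t: "finite t" "t \<subseteq> range (\<lambda>k. u ^ k)"
      "(\<Sum>v\<in>t. of_rat (c v) * v) = 0" "\<exists>v\<in>t. c v \<noteq> (0::rat)"
      unfolding rat.dependent_explicit by blast
    obtain I where I: "finite I" "t = (\<lambda>k. u ^ k) ` I"
      using finite_subset_image[OF t(1,2)] by blast
    define p :: "real poly" where "p = (\<Sum>k\<in>I. monom (of_rat (c (u ^ k))) k)"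
    have coeff: "coeff p i = (if i \<in> I then of_rat (c (u ^ i)) else 0)" for i
      unfolding p_def coeff_sum using I(1) by simp
    have "(\<Sum>k\<in>I. of_rat (c (u ^ k)) * u ^ k) = 0"
      using t(3) unfolding I(2) by (subst (asm) sum.reindex) (use True in \<open>auto intro: inj_on_subset\<close>)
    then have "poly p u = 0" by (simp add: p_def poly_sum poly_monom)
    moreover obtain k where "k \<in> I" "c (u ^ k) \<noteq> 0" using t(4) I(2) by auto
    then have "coeff p k \<noteq> 0" by (simp add: coeff)
    then have "p \<noteq> 0" by (metis coeff_0)
    ultimately show thesis by (intro that[of p]) (auto simp: coeff)
  qed
qed

subsection \<open>Rigid elements\<close>

text \<open>One condition covers addition (\<open>m = 1\<close>), multiplication
  (\<open>c = 0\<close>) and incidence with the line \<open>y = m x + c\<close>. The values at 0 and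
  1 are prescribed even if these lie outside \<open>S\<close>.\<close>

definition partial_embedding :: "real set \<Rightarrow> (real \<Rightarrow> real) \<Rightarrow> bool" where
  "partial_embedding S f \<longleftrightarrow> f 0 = 0 \<and> f 1 = 1 \<and> strict_mono_on S f \<and>
     (\<forall>m\<in>S. \<forall>x\<in>S. \<forall>c\<in>S. m * x + c \<in> S \<longrightarrow> f (m * x + c) = f m * f x + f c)"

definition rigid :: "real set \<Rightarrow> real \<Rightarrow> bool" where
  "rigid K x \<longleftrightarrow> (\<exists>S. finite S \<and> S \<subseteq> K \<and> (\<forall>f. partial_embedding S f \<longrightarrow> f x = x))"

lemma partial_embedding_subset:
  assumes "partial_embedding T f" "S \<subseteq> T"
  shows "partial_embedding S f"
  using assms unfolding partial_embedding_def by (meson monotone_on_subset subset_iff)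

lemma partial_embedding_affine:
  assumes "partial_embedding S f" "m \<in> S" "x \<in> S" "c \<in> S" "m * x + c \<in> S"
  shows "f (m * x + c) = f m * f x + f c"
  using assms unfolding partial_embedding_def by blast

text \<open>A partial embedding of a union restricts to each piece, so the union of the witness sets
  serves all of \<open>G\<close> at once.\<close>

lemma rigid_finite_set:
  assumes "finite G" "G \<subseteq> {x \<in> K. rigid K x}"
  obtains S where "finite S" "S \<subseteq> K" "G \<subseteq> S" "\<forall>f. partial_embedding S f \<longrightarrow> (\<forall>x\<in>G. f x = x)"
proof -
  have "\<forall>x\<in>G. \<exists>S. finite S \<and> S \<subseteq> K \<and> (\<forall>f. partial_embedding S f \<longrightarrow> f x = x)"
    using assms(2) unfolding rigid_def by blast
  then obtain S where S: "\<forall>x\<in>G. finite (S x) \<and> S x \<subseteq> K \<and> (\<forall>f. partial_embedding (S x) f \<longrightarrow> f x = x)"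
    by metis
  show thesis
  proof
    show "finite (G \<union> (\<Union>x\<in>G. S x))" "G \<union> (\<Union>x\<in>G. S x) \<subseteq> K" "G \<subseteq> G \<union> (\<Union>x\<in>G. S x)"
      using S assms by blast+
    show "\<forall>f. partial_embedding (G \<union> (\<Union>x\<in>G. S x)) f \<longrightarrow> (\<forall>x\<in>G. f x = x)"
    proof (intro allI impI ballI)
      fix f x
      assume f: "partial_embedding (G \<union> (\<Union>x\<in>G. S x)) f" and x: "x \<in> G"
      show "f x = x" using partial_embedding_subset[OF f, of "S x"] x S by blast
    qed
  qed
qed

text \<open>Products arise from evaluating \<open>m * x + c\<close> at fixed numbers, differences
  and inverses from solving an affine equation for \<open>x\<close>. Since a subfield contains the
  rationals, all rationals are thereby rigid.\<close>

lemma real_subfield_rigid: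
  assumes K: "real_subfield K"
  shows "real_subfield {x \<in> K. rigid K x}"
proof -
  have triv: "rigid K 0" "rigid K 1"
    unfolding rigid_def by (auto simp: partial_embedding_def intro!: exI[of _ "{}"])
  have affine: "rigid K (m * x + c)"
    if "m \<in> K" "x \<in> K" "c \<in> K" "rigid K m" "rigid K x" "rigid K c" for m x c
  proof -
    have "finite {m, x, c}" "{m, x, c} \<subseteq> {z \<in> K. rigid K z}" using that by auto
    then obtain S where S: "finite S" "S \<subseteq> K" "{m, x, c} \<subseteq> S"
      "\<forall>f. partial_embedding S f \<longrightarrow> (\<forall>z\<in>{m, x, c}. f z = z)"
      by (rule rigid_finite_set)
    have "f (m * x + c) = m * x + c" if f: "partial_embedding (insert (m * x + c) S) f" for f
    proof -
      have fx: "f m = m" "f x = x" "f c = c"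
        using S(4)[rule_format, OF partial_embedding_subset[OF f]] by blast+
      show ?thesis
        using partial_embedding_affine[OF f, of m x c] S(3) fx by auto
    qed
    moreover have "m * x + c \<in> K"
      using that real_subfield_add[OF K] real_subfield_mult[OF K] by blast
    ultimately show ?thesis
      unfolding rigid_def using S(1,2) by (intro exI[of _ "insert (m * x + c) S"]) auto
  qed
  have solve: "rigid K x"
    if "m \<noteq> 0" "m \<in> K" "x \<in> K" "c \<in> K" "m * x + c \<in> K" "rigid K m" "rigid K c" "rigid K (m * x + c)"
    for m x c
  proof -
    have "finite {m, c, m * x + c}" "{m, c, m * x + c} \<subseteq> {z \<in> K. rigid K z}" using that by auto
    then obtain S where S: "finite S" "S \<subseteq> K" "{m, c, m * x + c} \<subseteq> S"
      "\<forall>f. partial_embedding S f \<longrightarrow> (\<forall>z\<in>{m, c, m * x + c}. f z = z)"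
      by (rule rigid_finite_set)
    have "f x = x" if f: "partial_embedding (insert x S) f" for f
    proof -
      have fx: "f m = m" "f c = c" "f (m * x + c) = m * x + c"
        using S(4)[rule_format, OF partial_embedding_subset[OF f]] by blast+
      have "m * x + c = m * f x + c"
        using partial_embedding_affine[OF f, of m x c] S(3) fx by auto
      then show ?thesis using \<open>m \<noteq> 0\<close> by simp
    qed
    then show ?thesis
      unfolding rigid_def using S(1,2) that by (intro exI[of _ "insert x S"]) auto
  qed
  have K01: "0 \<in> K" "1 \<in> K" using K by (auto simp: real_subfield_iff)
  \<comment> \<open>The equations solved are \<open>1 * z + y = x\<close> for the difference and
    \<open>x * z + 0 = 1\<close> for the inverse.\<close>
  have "rigid K (x - y)" if "x \<in> K" "y \<in> K" "rigid K x" "rigid K y" for x y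
    using solve[of 1 "x - y" y] that triv K K01 by (simp add: real_subfield_iff)
  moreover have "rigid K (x * y)" if "x \<in> K" "y \<in> K" "rigid K x" "rigid K y" for x y
    using affine[of x y 0] that triv K01 by simp
  moreover have "rigid K (inverse x)" if "x \<in> K" "rigid K x" for x
    using solve[of x "inverse x" 0] that triv K K01 by (cases "x = 0") (auto simp: real_subfield_iff)
  ultimately show ?thesis
    using triv K unfolding real_subfield_iff by auto
qed

section \<open>Rigidity of algebraic numbers\<close>

lemma rational_isolation:
  fixes u :: real
  assumes "finite Z"
  obtains a b where "a \<in> \<rat>" "b \<in> \<rat>" "a < u" "u < b" "\<And>z. z \<in> Z \<Longrightarrow> a < z \<Longrightarrow> z < b \<Longrightarrow> z = u"
proof -
  \<comment> \<open>The 1 keeps the minimum defined when \<open>Z\<close> has no point other than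
    \<open>u\<close>.\<close>
  define d where "d = Min (insert 1 ((\<lambda>z. \<bar>z - u\<bar>) ` (Z - {u})))"
  have d: "d > 0" "\<forall>z\<in>Z. z \<noteq> u \<longrightarrow> d \<le> \<bar>z - u\<bar>"
    unfolding d_def using assms by auto
  obtain a where a: "a \<in> \<rat>" "u - d < a" "a < u"
    using Rats_dense_in_real[of "u - d" u] d by auto
  obtain b where b: "b \<in> \<rat>" "u < b" "b < u + d"
    using Rats_dense_in_real[of u "u + d"] d by auto
  show thesis
  proof
    show "z = u" if "z \<in> Z" "a < z" "z < b" for z
      using d(2) that a b by force
  qed (use a b in auto)
qed

text \<open>Each Horner step \<open>u * v + c\<close> is one affine relation, in which the rational
  \<open>c\<close> is fixed by rigidity. \<open>S\<close> collects the intermediate values and the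
  witness sets of the coefficients.\<close>

lemma horner_partial_embedding:
  assumes K: "real_subfield K" and "u \<in> K" and "\<And>i. coeff p i \<in> \<rat>"
  shows "\<exists>S. finite S \<and> S \<subseteq> K \<and> u \<in> S \<and> poly p u \<in> S \<and>
    (\<forall>f. partial_embedding S f \<longrightarrow> f (poly p u) = poly p (f u))"
  using assms(3)
proof (induction p rule: pCons_induct)
  case 0
  show ?case
    using K assms(2) by (intro exI[of _ "{0, u}"]) (auto simp: real_subfield_iff partial_embedding_def)
next
  case (pCons c p)
  have c: "c \<in> \<rat>" using pCons.prems[of 0] by simp
  have "coeff p i \<in> \<rat>" for i using pCons.prems[of "Suc i"] by simp
  then obtain S where S: "finite S" "S \<subseteq> K" "u \<in> S" "poly p u \<in> S"
    "\<And>f. partial_embedding S f \<Longrightarrow> f (poly p u) = poly p (f u)"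
    using pCons.IH by blast
  have "finite {c}" "{c} \<subseteq> {x \<in> K. rigid K x}"
    using Rats_subset_real_subfield[OF real_subfield_rigid[OF K]] c by auto
  then obtain T where T: "finite T" "T \<subseteq> K" "{c} \<subseteq> T"
    "\<forall>f. partial_embedding T f \<longrightarrow> (\<forall>x\<in>{c}. f x = x)"
    by (rule rigid_finite_set)
  define v where "v = u * poly p u + c"
  have v: "poly (pCons c p) u = v" by (simp add: v_def)
  have "v \<in> K"
    unfolding v_def using S(2-4) assms(2) T(2,3) by (intro real_subfield_add[OF K] real_subfield_mult[OF K]) auto
  moreover have "f v = poly (pCons c p) (f u)" if f: "partial_embedding (insert v (S \<union> T)) f" for f
  proof -
    have "f v = f u * f (poly p u) + f c"
      using partial_embedding_affine[OF f, of u "poly p u" c] S(3,4) T(3) unfolding v_def by auto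
    also have "f (poly p u) = poly p (f u)"
      using S(5) partial_embedding_subset[OF f] by blast
    also have "f c = c"
      using T(4) partial_embedding_subset[OF f] by blast
    finally show ?thesis by simp
  qed
  ultimately show ?case
    unfolding v using S(1-4) T(1-3) by (intro exI[of _ "insert v (S \<union> T)"]) auto
qed

text \<open>A partial embedding maps \<open>u\<close> to a root of its polynomial and, being monotone and fixing
  rationals, keeps it inside an isolating interval.\<close>

lemma rigid_if_finite_ext:
  assumes K: "real_subfield K" and fin: "finite_ext_of_rat K" and u: "u \<in> K"
  shows "rigid K u"
proof -
  obtain p :: "real poly" where p: "p \<noteq> 0" "\<And>i. coeff p i \<in> \<rat>" "poly p u = 0"
    using finite_ext_of_rat_algebraic[OF assms] by blast
  obtain a b where ab: "a \<in> \<rat>" "b \<in> \<rat>" "a < u" "u < b"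
    "\<And>z. poly p z = 0 \<Longrightarrow> a < z \<Longrightarrow> z < b \<Longrightarrow> z = u"
    using rational_isolation[OF poly_roots_finite[OF p(1)], of u] by auto
  obtain S where S: "finite S" "S \<subseteq> K" "u \<in> S"
    "\<And>f. partial_embedding S f \<Longrightarrow> f (poly p u) = poly p (f u)"
    using horner_partial_embedding[OF K u p(2)] by blast
  have "finite {a, b}" "{a, b} \<subseteq> {x \<in> K. rigid K x}"
    using Rats_subset_real_subfield[OF real_subfield_rigid[OF K]] ab(1,2) by auto
  then obtain T where T: "finite T" "T \<subseteq> K" "{a, b} \<subseteq> T"
    "\<forall>f. partial_embedding T f \<longrightarrow> (\<forall>x\<in>{a, b}. f x = x)"
    by (rule rigid_finite_set)
  have "f u = u" if f: "partial_embedding (S \<union> T) f" for f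
  proof (rule ab(5))
    show "poly p (f u) = 0"
      using S(4)[OF partial_embedding_subset[OF f Un_upper1]] p(3) f
      by (simp add: partial_embedding_def)
    have "strict_mono_on (S \<union> T) f" using f by (simp add: partial_embedding_def)
    then have "f a < f u" "f u < f b"
      using ab(3,4) S(3) T(3) by (auto simp: strict_mono_on_def)
    moreover have "f a = a" "f b = b"
      using T(4)[rule_format, OF partial_embedding_subset[OF f Un_upper2]] by blast+
    ultimately show "a < f u" "f u < b" by auto
  qed
  moreover have "finite (S \<union> T)" "S \<union> T \<subseteq> K" using S(1,2) T(1,2) by auto
  ultimately show ?thesis unfolding rigid_def by blast
qed

subsection \<open>Rank\<close>

text \<open>A coordinate at which only \<open>u\<close> is nonzero isolates the coefficient of
  \<open>u\<close>, so \<open>U\<close> is independent. A column outside its span would give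
  \<open>card U + 1\<close> independent columns, more than the rank allows.\<close>

lemma (in vec_space) mem_span_if_rank_le:
  assumes A: "A \<in> carrier_mat n nc" and U: "U \<subseteq> set (cols A)"
    and diag: "\<And>u. u \<in> U \<Longrightarrow> \<exists>i<n. u $ i \<noteq> 0 \<and> (\<forall>w\<in>U. w \<noteq> u \<longrightarrow> w $ i = 0)"
    and rank: "rank A \<le> card U" and v: "v \<in> set (cols A)"
  shows "\<exists>a. \<forall>i<n. v $ i = (\<Sum>u\<in>U. a u * u $ i)"
proof -
  have colsA: "set (cols A) \<subseteq> carrier_vec n" using A cols_dim by blast
  have fin: "finite U" using U finite_subset by blast
  have UC: "U \<subseteq> carrier_vec n" using U colsA by blast
  have zero: "a u = 0" if z: "lincomb a U = 0\<^sub>v n" and u: "u \<in> U" for a u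
  proof -
    obtain i where i: "i < n" "u $ i \<noteq> 0" "\<forall>w\<in>U. w \<noteq> u \<longrightarrow> w $ i = 0" using diag[OF u] by blast
    have "0 = (\<Sum>w\<in>U. a w * w $ i)"
      using lincomb_index[OF i(1) UC, of a] z i(1) by simp
    also have "\<dots> = (\<Sum>w\<in>U. if w = u then a u * u $ i else 0)"
      by (rule sum.cong) (use i in auto)
    also have "\<dots> = a u * u $ i" using fin u by simp
    finally show ?thesis using i(2) by simp
  qed
  have ind: "lin_indpt U"
    by (rule finite_lin_indpt2[OF fin]) (use UC zero in auto)
  have "v \<in> span U"
  proof (rule ccontr)
    assume v': "v \<notin> span U"
    then have vU: "v \<notin> U" using span_mem[OF UC] by blast
    have "lin_indpt (insert v U)"
      using lin_dep_iff_in_span[OF UC ind _ vU] v' v colsA by auto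
    then have "card (insert v U) \<le> rank A"
      using U v by (intro rank_ge_card_indpt[OF A]) auto
    then show False using rank vU fin by simp
  qed
  then obtain a where "v = lincomb a U"
    using finite_in_span[OF fin UC] by blast
  then show ?thesis using lincomb_index[OF _ UC] by auto
qed

lemma (in vec_space) rank_le_3_if_entries:
  fixes f1 f2 f3 g1 g2 g3 :: "nat \<Rightarrow> 'a"
  shows "rank (mat n nc (\<lambda>(i, j). f1 i * g1 j + f2 i * g2 j + f3 i * g3 j)) \<le> 3"
proof -
  let ?M = "\<lambda>f g :: nat \<Rightarrow> 'a. mat n nc (\<lambda>(i, j). f i * g j)"
  have one: "rank (?M f g) \<le> 1" for f g
    by (rule rank_le_1_product_entries[where f = f and g = g]) auto
  have "mat n nc (\<lambda>(i, j). f1 i * g1 j + f2 i * g2 j + f3 i * g3 j) = ?M f1 g1 + ?M f2 g2 + ?M f3 g3"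
    by (rule eq_matI) auto
  then have "rank (mat n nc (\<lambda>(i, j). f1 i * g1 j + f2 i * g2 j + f3 i * g3 j))
      \<le> rank (?M f1 g1 + ?M f2 g2) + rank (?M f3 g3)"
    using rank_subadditive[of "?M f1 g1 + ?M f2 g2" nc "?M f3 g3"] by simp
  also have "rank (?M f1 g1 + ?M f2 g2) \<le> rank (?M f1 g1) + rank (?M f2 g2)"
    by (rule rank_subadditive) auto
  finally show ?thesis using one[of f1 g1] one[of f2 g2] one[of f3 g3] by linarith
qed

subsection \<open>The incidence pattern of a finite set of numbers\<close>

text \<open>Lines and points of the projective plane: \<open>Slope m c\<close> is the line \<open>y = m x + c\<close>,
  \<open>Vertical c\<close> the line \<open>x = c\<close>, \<open>Dir m\<close> the point at infinity of the lines of slope \<open>m\<close>,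
  and \<open>VDir\<close> that of the vertical lines.\<close>

datatype line = Slope real real | Vertical real | Line_at_infinity

datatype point = Affine real real | Dir real | VDir

fun line_coords :: "line \<Rightarrow> real \<times> real \<times> real" where
  "line_coords (Slope m c) = (m, c, -1)"
| "line_coords (Vertical c) = (1, -c, 0)"
| "line_coords Line_at_infinity = (0, 1, 0)"

fun point_coords :: "point \<Rightarrow> real \<times> real \<times> real" where
  "point_coords (Affine x y) = (x, 1, y)"
| "point_coords (Dir m) = (1, 0, m)"
| "point_coords VDir = (0, 0, 1)"

text \<open>For \<open>Slope m c\<close> and \<open>Affine x y\<close> this is
  \<open>m * x + c - y\<close>, and for \<open>Vertical c\<close> it is \<open>x - c\<close>. The
  sign thus also tells the side of the line, which carries the order of \<open>S\<close>.\<close>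

definition incidence :: "line \<Rightarrow> point \<Rightarrow> real" where
  "incidence l p = (case (line_coords l, point_coords p) of ((a, b, c), (x, w, y)) \<Rightarrow> a * x + b * w + c * y)"

definition lines_over :: "real set \<Rightarrow> line set" where
  "lines_over S = (\<lambda>(m, c). Slope m c) ` (S \<times> S) \<union> Vertical ` S \<union> {Line_at_infinity}"

definition points_over :: "real set \<Rightarrow> point set" where
  "points_over S = (\<lambda>(x, y). Affine x y) ` (S \<times> S) \<union> Dir ` S \<union> {VDir}"

lemma finite_lines_over: "finite S \<Longrightarrow> finite (lines_over S)"
  by (simp add: lines_over_def)

lemma finite_points_over: "finite S \<Longrightarrow> finite (points_over S)"
  by (simp add: points_over_def)

lemma lines_over_iff:
  "Slope m c \<in> lines_over S \<longleftrightarrow> m \<in> S \<and> c \<in> S"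
  "Vertical c \<in> lines_over S \<longleftrightarrow> c \<in> S"
  "Line_at_infinity \<in> lines_over S"
  by (auto simp: lines_over_def)

lemma points_over_iff:
  "Affine x y \<in> points_over S \<longleftrightarrow> x \<in> S \<and> y \<in> S"
  "Dir m \<in> points_over S \<longleftrightarrow> m \<in> S"
  "VDir \<in> points_over S"
  by (auto simp: points_over_def)

lemma incidence_mem:
  assumes "real_subfield K" "S \<subseteq> K" "l \<in> lines_over S" "p \<in> points_over S"
  shows "incidence l p \<in> K"
proof -
  have "0 \<in> K" "1 \<in> K" using assms(1) by (auto simp: real_subfield_iff)
  then show ?thesis
    using assms(2-4) real_subfield_add[OF assms(1)] real_subfield_mult[OF assms(1)]
      real_subfield_uminus[OF assms(1)]
    by (cases l; cases p) (auto simp: incidence_def lines_over_iff points_over_iff subset_iff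
        diff_conv_add_uminus simp del: add_uminus_conv_diff)
qed

section \<open>Coordinates from a realization of the pattern\<close>

lemma sgn_eq_if_sign_of_eq:
  assumes "sign_of x = sign_of y"
  shows "sgn x = sgn y"
  using assms by (auto simp: sign_of_def split: if_splits)

text \<open>Reading off the coordinates of the points and lines in the frame \<open>Dir 0\<close>, \<open>Affine 0 0\<close>,
  \<open>VDir\<close>: the abscissa of \<open>Affine x y\<close> is \<open>\<kappa> x\<close>, its ordinate \<open>\<tau> y\<close>, and the slope of
  \<open>Slope m c\<close> is \<open>\<mu> m\<close>. The three functions agree up to a factor, and \<open>\<kappa>\<close> normalised by
  \<open>\<kappa> 1\<close> is the embedding.\<close>

lemma partial_embedding_of_realization:
  fixes g :: "line \<Rightarrow> point \<Rightarrow> real"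
  assumes S: "0 \<in> S" "1 \<in> S"
    and F: "real_subfield F" "\<And>l p. l \<in> lines_over S \<Longrightarrow> p \<in> points_over S \<Longrightarrow> g l p \<in> F"
    and sgn: "\<And>l p. l \<in> lines_over S \<Longrightarrow> p \<in> points_over S \<Longrightarrow> sgn (g l p) = sgn (incidence l p)"
    and span: "\<And>p. p \<in> points_over S \<Longrightarrow> \<exists>X W Y. \<forall>l \<in> lines_over S.
       g l p = X * g l (Dir 0) + W * g l (Affine 0 0) + Y * g l VDir"
  shows "\<exists>f. partial_embedding S f \<and> f ` S \<subseteq> F"
proof -
  obtain X W Y where XWY: "\<And>p l. p \<in> points_over S \<Longrightarrow> l \<in> lines_over S \<Longrightarrow>
      g l p = X p * g l (Dir 0) + W p * g l (Affine 0 0) + Y p * g l VDir"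
    using span by metis
  \<comment> \<open>\<open>X\<close>, \<open>W\<close>, \<open>Y\<close> act as homogeneous
    coordinates of points and \<alpha>, \<beta>, \<gamma> as those of lines. Only the latter are
    known to lie in \<open>F\<close>.\<close>
  define \<alpha> \<beta> \<gamma> where "\<alpha> l = g l (Dir 0)" and "\<beta> l = g l (Affine 0 0)" and "\<gamma> l = g l VDir" for l
  note mem = lines_over_iff points_over_iff S
  note inc = incidence_def
  have g: "g l p = X p * \<alpha> l + W p * \<beta> l + Y p * \<gamma> l"
    if "l \<in> lines_over S" "p \<in> points_over S" for l p
    using XWY that by (simp add: \<alpha>_def \<beta>_def \<gamma>_def)
  have pos: "0 < g l p" if "l \<in> lines_over S" "p \<in> points_over S" "0 < incidence l p" for l p
    using sgn[OF that(1,2)] that(3) by (simp add: sgn_1_pos)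
  have neg: "g l p < 0" if "l \<in> lines_over S" "p \<in> points_over S" "incidence l p < 0" for l p
    using sgn[OF that(1,2)] that(3) by (simp add: sgn_1_neg)
  have zero: "g l p = 0" if "l \<in> lines_over S" "p \<in> points_over S" "incidence l p = 0" for l p
    using sgn[OF that(1,2)] that(3) by (simp add: sgn_0_0)

  \<comment> \<open>Each of \<open>Line_at_infinity\<close>, \<open>Vertical 0\<close> and
    \<open>Slope 0 0\<close> pairs to a nonzero value with just one frame point, so it isolates one
    coordinate.\<close>
  have Inf: "\<alpha> Line_at_infinity = 0" "\<gamma> Line_at_infinity = 0" "\<beta> Line_at_infinity > 0"
    unfolding \<alpha>_def \<beta>_def \<gamma>_def by (auto intro!: zero pos simp: mem inc)
  have V0: "\<beta> (Vertical 0) = 0"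
    unfolding \<beta>_def by (auto intro!: zero simp: mem inc)
  have V: "\<alpha> (Vertical c) > 0" "\<gamma> (Vertical c) = 0" if "c \<in> S" for c
    unfolding \<alpha>_def \<gamma>_def using that by (auto intro!: zero pos simp: mem inc)
  have L0: "\<alpha> (Slope 0 0) = 0" "\<beta> (Slope 0 0) = 0"
    unfolding \<alpha>_def \<beta>_def by (auto intro!: zero simp: mem inc)
  have L: "\<gamma> (Slope m c) < 0" if "m \<in> S" "c \<in> S" for m c
    unfolding \<gamma>_def using that by (auto intro!: neg simp: mem inc)
  have W_pos: "W (Affine x y) > 0" if "x \<in> S" "y \<in> S" for x y
    using pos[of Line_at_infinity "Affine x y"] g[of Line_at_infinity "Affine x y"] that Inf
    by (auto simp: mem inc zero_less_mult_iff)
  have W_Dir: "W (Dir m) = 0" if "m \<in> S" for m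
    using zero[of Line_at_infinity "Dir m"] g[of Line_at_infinity "Dir m"] that Inf
    by (auto simp: mem inc)
  have X_Dir: "X (Dir m) > 0" if "m \<in> S" for m
    using pos[of "Vertical 0" "Dir m"] g[of "Vertical 0" "Dir m"] that V[OF S(1)] V0
    by (auto simp: mem inc zero_less_mult_iff)

  \<comment> \<open>Reading \<kappa> off the vertical lines rather than as \<open>X / W\<close>
    makes it a quotient of values of \<open>g\<close>, hence an element of \<open>F\<close>.\<close>
  define \<kappa> where "\<kappa> c = - \<beta> (Vertical c) / \<alpha> (Vertical c)" for c
  define \<mu> where "\<mu> m = Y (Dir m) / X (Dir m)" for m
  define \<tau> where "\<tau> c = Y (Affine 0 c) / W (Affine 0 c)" for c
  have \<beta>V: "\<beta> (Vertical c) = - \<kappa> c * \<alpha> (Vertical c)" if "c \<in> S" for c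
    using V[OF that] by (simp add: \<kappa>_def)
  have X: "X (Affine x y) = \<kappa> x * W (Affine x y)" if "x \<in> S" "y \<in> S" for x y
  proof -
    have "X (Affine x y) * \<alpha> (Vertical x) + W (Affine x y) * \<beta> (Vertical x) = 0"
      using zero[of "Vertical x" "Affine x y"] g[of "Vertical x" "Affine x y"] that V[of x]
      by (auto simp: mem inc)
    then have "\<alpha> (Vertical x) * (X (Affine x y) - \<kappa> x * W (Affine x y)) = 0"
      using that by (simp add: \<beta>V algebra_simps)
    then show ?thesis using V[of x] that by simp
  qed
  have \<kappa>0: "\<kappa> 0 = 0" using V0 by (simp add: \<kappa>_def)
  have \<alpha>L: "\<alpha> (Slope m c) = - \<mu> m * \<gamma> (Slope m c)" if "m \<in> S" "c \<in> S" for m c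
  proof -
    have "X (Dir m) * \<alpha> (Slope m c) + Y (Dir m) * \<gamma> (Slope m c) = 0"
      using zero[of "Slope m c" "Dir m"] g[of "Slope m c" "Dir m"] that W_Dir[of m]
      by (auto simp: mem inc)
    then show ?thesis using X_Dir[of m] that by (simp add: \<mu>_def field_simps)
  qed
  have \<beta>L: "\<beta> (Slope m c) = - \<tau> c * \<gamma> (Slope m c)" if "m \<in> S" "c \<in> S" for m c
  proof -
    have "W (Affine 0 c) * \<beta> (Slope m c) + Y (Affine 0 c) * \<gamma> (Slope m c) = 0"
      using zero[of "Slope m c" "Affine 0 c"] g[of "Slope m c" "Affine 0 c"] that X[of 0 c] \<kappa>0
      by (auto simp: mem inc)
    then show ?thesis using W_pos[of 0 c] that S by (simp add: \<tau>_def field_simps)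
  qed
  have \<mu>0: "\<mu> 0 = 0" and \<tau>0: "\<tau> 0 = 0"
    using \<alpha>L[OF S(1) S(1)] \<beta>L[OF S(1) S(1)] L0 L[OF S(1) S(1)] by auto
  have Y: "Y (Affine x y) = (\<mu> m * \<kappa> x + \<tau> c) * W (Affine x y)"
    if "m \<in> S" "x \<in> S" "c \<in> S" "y \<in> S" "y = m * x + c" for m x c y
  proof -
    have "X (Affine x y) * \<alpha> (Slope m c) + W (Affine x y) * \<beta> (Slope m c)
        + Y (Affine x y) * \<gamma> (Slope m c) = 0"
      using zero[of "Slope m c" "Affine x y"] g[of "Slope m c" "Affine x y"] that
      by (auto simp: mem inc)
    then have "\<gamma> (Slope m c) * (Y (Affine x y) - (\<mu> m * \<kappa> x + \<tau> c) * W (Affine x y)) = 0"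
      using that by (simp add: \<alpha>L \<beta>L X algebra_simps)
    then show ?thesis using L[of m c] that by simp
  qed
  \<comment> \<open>\<open>Affine x y\<close> lies on \<open>Slope m c\<close> and on the horizontal
    line \<open>Slope 0 y\<close>; the two expressions for its ordinate agree.\<close>
  have \<tau>: "\<tau> y = \<mu> m * \<kappa> x + \<tau> c" if "m \<in> S" "x \<in> S" "c \<in> S" "y \<in> S" "y = m * x + c" for m x c y
    using Y[OF that] Y[of 0 x y y] that S \<mu>0 W_pos[of x y] by simp
  \<comment> \<open>\<open>Affine x 0\<close> lies strictly to the right of
    \<open>Vertical c\<close>, and the realization keeps this sign.\<close>
  have \<kappa>_less: "\<kappa> c < \<kappa> x" if "c \<in> S" "x \<in> S" "c < x" for c x
  proof -
    have "X (Affine x 0) * \<alpha> (Vertical c) + W (Affine x 0) * \<beta> (Vertical c) > 0"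
      using pos[of "Vertical c" "Affine x 0"] g[of "Vertical c" "Affine x 0"] that V[of c]
      by (auto simp: mem inc)
    then have "(\<alpha> (Vertical c) * W (Affine x 0)) * (\<kappa> x - \<kappa> c) > 0"
      using that S by (simp add: X \<beta>V algebra_simps)
    then have "\<kappa> x - \<kappa> c > 0"
      by (rule zero_less_mult_pos) (use V[of c] W_pos[of x 0] that S in auto)
    then show ?thesis by simp
  qed
  have \<kappa>1: "\<kappa> 1 > 0" using \<kappa>_less[of 0 1] S \<kappa>0 by simp
  \<comment> \<open>The line \<open>y = x\<close> relates \<tau> to \<kappa>; the line
    \<open>y = m x\<close> at abscissa 1 relates \<tau> to \<mu>.\<close>
  have \<tau>_\<kappa>: "\<tau> x = \<mu> 1 * \<kappa> x" if "x \<in> S" for x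
    using \<tau>[of 1 x 0 x] that S \<tau>0 by simp
  have \<tau>_\<mu>: "\<tau> m = \<mu> m * \<kappa> 1" if "m \<in> S" for m
    using \<tau>[of m 1 0 m] that S \<tau>0 by simp
  have "\<tau> 1 \<noteq> 0"
  proof -
    have "Y (Affine 0 1) * \<gamma> (Slope 0 0) < 0"
      using neg[of "Slope 0 0" "Affine 0 1"] g[of "Slope 0 0" "Affine 0 1"] L0 by (auto simp: mem inc)
    then show ?thesis using W_pos[of 0 1] S by (auto simp: \<tau>_def)
  qed
  then have \<mu>1: "\<mu> 1 \<noteq> 0" using \<tau>_\<kappa>[OF S(2)] by auto

  define f where "f x = \<kappa> x / \<kappa> 1" for x
  have "f (m * x + c) = f m * f x + f c" if "m \<in> S" "x \<in> S" "c \<in> S" "m * x + c \<in> S" for m x c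
  proof -
    have m: "\<mu> m = \<mu> 1 * f m"
      using \<tau>_\<kappa>[OF that(1)] \<tau>_\<mu>[OF that(1)] \<kappa>1 by (simp add: f_def field_simps)
    have "\<mu> 1 * \<kappa> (m * x + c) = \<mu> 1 * (f m * \<kappa> x + \<kappa> c)"
      using \<tau>[OF that refl] that by (simp add: \<tau>_\<kappa> m algebra_simps)
    then have "\<kappa> (m * x + c) = f m * \<kappa> x + \<kappa> c" using \<mu>1 by simp
    then show ?thesis by (simp add: f_def[of "m * x + c"] f_def[of x] f_def[of c] add_divide_distrib)
  qed
  moreover have "strict_mono_on S f"
    using \<kappa>_less \<kappa>1 by (auto simp: strict_mono_on_def f_def divide_strict_right_mono)
  moreover have "f 0 = 0" "f 1 = 1" using \<kappa>0 \<kappa>1 by (auto simp: f_def)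
  moreover have "\<kappa> x \<in> F" if "x \<in> S" for x
    unfolding \<kappa>_def \<alpha>_def \<beta>_def using that
    by (intro real_subfield_divide[OF F(1)] real_subfield_uminus[OF F(1)] F(2)) (auto simp: mem)
  then have "f ` S \<subseteq> F"
    using S by (auto simp: f_def intro!: real_subfield_divide[OF F(1)])
  ultimately show ?thesis unfolding partial_embedding_def by blast
qed

text \<open>The incidences themselves form a matrix whose entries are sums of three products, hence
  of rank at most 3. Conversely, in a realization of rank at most 3 the three frame columns span all
  columns, which yields coordinates.\<close>

lemma finite_set_incidence_pattern:
  assumes "finite S" "0 \<in> S" "1 \<in> S"
  shows "\<exists>A :: sign_pattern.
    (\<forall>K. real_subfield K \<and> S \<subseteq> K \<longrightarrow> min_rank K A \<le> 3) \<and>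
    (\<forall>F. real_subfield F \<and> min_rank F A \<le> 3 \<longrightarrow> (\<exists>f. partial_embedding S f \<and> f ` S \<subseteq> F))"
proof -
  obtain ls where ls: "set ls = lines_over S"
    using finite_list[OF finite_lines_over[OF assms(1)]] by blast
  obtain ps where ps: "set ps = points_over S"
    using finite_list[OF finite_points_over[OF assms(1)]] by blast
  define n where "n = length ls"
  define nc where "nc = length ps"
  define A where "A = mat n nc (\<lambda>(i, j). sign_of (incidence (ls ! i) (ps ! j)))"
  interpret vec_space "TYPE(real)" n .
  show ?thesis
  proof (intro exI[of _ A] conjI allI impI; elim conjE)
    fix K
    assume K: "real_subfield K" "S \<subseteq> K"
    define B where "B = mat n nc (\<lambda>(i, j). incidence (ls ! i) (ps ! j))"
    have "incidence (ls ! i) (ps ! j) \<in> K" if "i < n" "j < nc" for i j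
      using that ls ps unfolding n_def nc_def by (intro incidence_mem[OF K]) (metis nth_mem)+
    then have "elements_mat B \<subseteq> K" by (auto simp: B_def elements_mat_def)
    then have "B \<in> qual_class K A"
      by (auto simp: qual_class_def sgn_mat_def A_def B_def intro!: eq_matI)
    moreover have "rank B \<le> 3"
    proof -
      have "B = mat n nc (\<lambda>(i, j).
          fst (line_coords (ls ! i)) * fst (point_coords (ps ! j))
        + fst (snd (line_coords (ls ! i))) * fst (snd (point_coords (ps ! j)))
        + snd (snd (line_coords (ls ! i))) * snd (snd (point_coords (ps ! j))))"
        unfolding B_def by (intro cong_mat) (auto simp: incidence_def split: prod.splits)
      then show ?thesis by (simp only: rank_le_3_if_entries)
    qed
    then have "real_rank B \<le> 3" by (simp add: real_rank_def B_def)
    ultimately show "min_rank K A \<le> 3"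
      using min_rank_attained[OF K(1), of A] by (metis order_trans)
  next
    fix F
    assume F: "real_subfield F" "min_rank F A \<le> 3"
    obtain B where B: "B \<in> qual_class F A" "real_rank B \<le> 3"
      using min_rank_attained[OF F(1), of A] F(2) by metis
    have AB: "map_mat sign_of B = A" and BF: "elements_mat B \<subseteq> F"
      using B(1) by (auto simp: qual_class_def sgn_mat_def)
    have dims: "dim_row B = n" "dim_col B = nc"
      using arg_cong[OF AB, of dim_row] arg_cong[OF AB, of dim_col] by (auto simp: A_def)
    then have Bc: "B \<in> carrier_mat n nc" by auto
    have rank: "rank B \<le> 3" using B(2) dims by (simp add: real_rank_def)
    have "\<forall>l\<in>lines_over S. \<exists>i<n. ls ! i = l" "\<forall>p\<in>points_over S. \<exists>j<nc. ps ! j = p"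
      unfolding n_def nc_def using ls ps by (metis in_set_conv_nth)+
    \<comment> \<open>The lists may have repetitions; \<open>r\<close> and \<open>k\<close> choose
      one row per line and one column per point.\<close>
    then obtain r k where r: "\<And>l. l \<in> lines_over S \<Longrightarrow> r l < n \<and> ls ! r l = l"
      and k: "\<And>p. p \<in> points_over S \<Longrightarrow> k p < nc \<and> ps ! k p = p"
      by metis
    define g where "g l p = B $$ (r l, k p)" for l p
    have col: "col B (k p) $ r l = g l p" if "l \<in> lines_over S" "p \<in> points_over S" for l p
      using r[OF that(1)] k[OF that(2)] dims by (simp add: g_def)
    have gF: "g l p \<in> F" if "l \<in> lines_over S" "p \<in> points_over S" for l p
      using r[OF that(1)] k[OF that(2)] Bc BF unfolding g_def by blast
    have sgn: "sgn (g l p) = sgn (incidence l p)" if "l \<in> lines_over S" "p \<in> points_over S" for l p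
    proof -
      have "sign_of (g l p) = A $$ (r l, k p)"
        using AB r[OF that(1)] k[OF that(2)] dims unfolding g_def by (metis index_map_mat(1))
      then show ?thesis
        using r[OF that(1)] k[OF that(2)] by (intro sgn_eq_if_sign_of_eq) (simp add: A_def)
    qed
    define D N E where "D = col B (k (Dir 0))" and "N = col B (k (Affine 0 0))"
      and "E = col B (k VDir)"
    note mem = lines_over_iff points_over_iff assms(2,3)
    \<comment> \<open>The rows of the three frame lines cut a diagonal block with nonzero diagonal
      out of the frame columns.\<close>
    have frame: "D $ r (Vertical 0) \<noteq> 0" "N $ r (Vertical 0) = 0" "E $ r (Vertical 0) = 0"
      "D $ r Line_at_infinity = 0" "N $ r Line_at_infinity \<noteq> 0" "E $ r Line_at_infinity = 0"
      "D $ r (Slope 0 0) = 0" "N $ r (Slope 0 0) = 0" "E $ r (Slope 0 0) \<noteq> 0"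
      using sgn[of "Vertical 0" "Dir 0"] sgn[of "Vertical 0" "Affine 0 0"] sgn[of "Vertical 0" VDir]
        sgn[of Line_at_infinity "Dir 0"] sgn[of Line_at_infinity "Affine 0 0"]
        sgn[of Line_at_infinity VDir]
        sgn[of "Slope 0 0" "Dir 0"] sgn[of "Slope 0 0" "Affine 0 0"] sgn[of "Slope 0 0" VDir]
      unfolding D_def N_def E_def by (auto simp: col mem incidence_def sgn_0_0)
    have dist: "D \<noteq> N" "D \<noteq> E" "N \<noteq> E" using frame by metis+
    have "\<exists>X W Y. \<forall>l \<in> lines_over S. g l p = X * g l (Dir 0) + W * g l (Affine 0 0) + Y * g l VDir"
      if p: "p \<in> points_over S" for p
    proof -
      have cols: "col B (k q) \<in> set (cols B)" if "q \<in> points_over S" for q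
        using k[OF that] dims by (auto simp: cols_def)
      have rows: "r (Vertical 0) < n" "r Line_at_infinity < n" "r (Slope 0 0) < n"
        using r by (auto simp: mem)
      have "\<exists>a. \<forall>i<n. col B (k p) $ i = (\<Sum>u\<in>{D, N, E}. a u * u $ i)"
      proof (rule mem_span_if_rank_le[OF Bc])
        show "{D, N, E} \<subseteq> set (cols B)"
          unfolding D_def N_def E_def by (auto intro!: cols simp: mem)
        show "\<exists>i<n. u $ i \<noteq> 0 \<and> (\<forall>w\<in>{D, N, E}. w \<noteq> u \<longrightarrow> w $ i = 0)" if "u \<in> {D, N, E}" for u
          using that frame rows by blast
        show "rank B \<le> card {D, N, E}" using rank dist by simp
        show "col B (k p) \<in> set (cols B)" using cols p by blast
      qed
      then obtain a where a: "\<forall>i<n. col B (k p) $ i = (\<Sum>u\<in>{D, N, E}. a u * u $ i)" by blast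
      have "g l p = a D * g l (Dir 0) + a N * g l (Affine 0 0) + a E * g l VDir"
        if l: "l \<in> lines_over S" for l
      proof -
        have "g l p = a D * D $ r l + a N * N $ r l + a E * E $ r l"
          using a r[OF l] dist col[OF l p] by simp
        then show ?thesis unfolding D_def N_def E_def using l by (simp add: col mem)
      qed
      then show ?thesis by blast
    qed
    then show "\<exists>f. partial_embedding S f \<and> f ` S \<subseteq> F"
      using partial_embedding_of_realization[OF assms(2,3) F(1) gF sgn] by blast
  qed
qed

section \<open>Comparison of both minimum ranks with 3\<close>

theorem theorem2:
  fixes K :: "real set"
  assumes "real_subfield K" and "finite_ext_of_rat K"
  shows "\<exists>A :: sign_pattern. \<forall>K1 :: real set.
           real_subfield K1 \<and> \<not> K \<subseteq> K1 \<longrightarrow> min_rank K A < min_rank K1 A"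
proof -
  obtain G where G: "finite G" "G \<subseteq> K" "\<And>F. real_subfield F \<Longrightarrow> G \<subseteq> F \<Longrightarrow> K \<subseteq> F"
    using finite_ext_of_rat_generators[OF assms(2)] by blast
  have "G \<subseteq> {x \<in> K. rigid K x}" using rigid_if_finite_ext[OF assms] G(2) by blast
  with G(1) obtain S where S: "finite S" "S \<subseteq> K" "G \<subseteq> S"
    "\<forall>f. partial_embedding S f \<longrightarrow> (\<forall>x\<in>G. f x = x)"
    by (rule rigid_finite_set)
  \<comment> \<open>The frame and the unit require 0 and 1. They lie in every subfield, and partial
    embeddings of the larger set restrict to \<open>S\<close>.\<close>
  obtain A :: sign_pattern where A:
    "\<forall>F. real_subfield F \<and> S \<union> {0, 1} \<subseteq> F \<longrightarrow> min_rank F A \<le> 3"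
    "\<forall>F. real_subfield F \<and> min_rank F A \<le> 3 \<longrightarrow>
       (\<exists>f. partial_embedding (S \<union> {0, 1}) f \<and> f ` (S \<union> {0, 1}) \<subseteq> F)"
    using finite_set_incidence_pattern[of "S \<union> {0, 1}"] S(1)
    by (metis UnI2 finite.emptyI finite_Un finite_insert insertI1 insertI2)
  have "min_rank K A \<le> 3"
    using A(1) S(2) assms(1) by (auto simp: real_subfield_iff)
  \<comment> \<open>Rank at most 3 over \<open>K1\<close> would give a partial embedding with values
    in \<open>K1\<close> that fixes \<open>G\<close>, so \<open>K1\<close> would contain the
    generators of \<open>K\<close>.\<close>
  moreover have "3 < min_rank K1 A" if K1: "real_subfield K1" "\<not> K \<subseteq> K1" for K1
  proof (rule ccontr)
    assume "\<not> 3 < min_rank K1 A"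
    then obtain f where f: "partial_embedding (S \<union> {0, 1}) f" "f ` (S \<union> {0, 1}) \<subseteq> K1"
      using A(2) K1(1) by (meson linorder_not_less)
    have "x \<in> K1" if "x \<in> G" for x
      using S(4)[rule_format, OF partial_embedding_subset[OF f(1)], of x] f(2) S(3) that by force
    then show False using G(3)[OF K1(1)] K1(2) by blast
  qed
  ultimately show ?thesis by (meson order.strict_trans1)
qed

end
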